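(* A function $f:\mathcal{S}^{3\times 3}\to\mathbb{R}$ is symmetric polyconvex if and only if there exists a convex function $g:\mathcal{S}^{3\times 3}\times \mathcal{S}^{3\times 3} \to \mathbb{R}$ such that $\partial_2 g (\varepsilon, \eta)\subset \mathcal{S}^{3\times 3}_-$ for every $\varepsilon, \eta \in \mathcal{S}^{3\times 3}$ and $$f(\varepsilon) = g(\varepsilon, \operatorname{cof} \varepsilon) \quad \text{for all } \varepsilon\in \mathcal{S}^{3\times 3}.$$
   Context: $\mathcal{S}^{3\times 3}$ is the space of symmetric matrices in $\mathbb{R}^{3\times 3}$, $\mathcal{S}^{3\times 3}_-$ the subset of negative semi-definite ones, $F^s=\frac12(F+F^T)$, and $A:B=\sum_{i,j}A_{ij}B_{ij}$. The cofactor matrix of $F\in\mathbb{R}^{3\times 3}$ is $(\operatorname{cof}F)_{ij}=(-1)^{i+j}\det\widehat F_{ij}$, where $\widehat F_{ij}$ is $F$ with row $i$ and column $j$ deleted; $\operatorname{cof}\varepsilon$ is symmetric if $\varepsilon$ is. A function $\tilde f:\mathbb{R}^{3\times 3}\to\mathbb{R}$ is polyconvex if there is a convex function $G:\mathbb{R}^{3\times 3}\times\mathbb{R}^{3\times 3}\times\mathbb{R}\to\mathbb{R}$ with $\tilde f(F)=G(F,\operatorname{cof}F,\det F)$ for all $F$. A function $f:\mathcal{S}^{3\times 3}\to\mathbb{R}$ is symmetric polyconvex if $\tilde f:\mathbb{R}^{3\times 3}\to\mathbb{R}$, $\tilde f(F)=f(F^s)$, is polyconvex. For convex $g$ on $\mathcal{S}^{3\times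 3}\times\mathcal{S}^{3\times 3}$, the partial subdifferential in the second variable is $$\partial_2 g(\varepsilon,\eta)=\{B\in\mathcal{S}^{3\times 3}: g(\varepsilon,\tilde\eta)\ge g(\varepsilon,\eta)+B:(\tilde\eta-\eta)\ \text{for all }\tilde\eta\in\mathcal{S}^{3\times 3}\}.$$ *)

theory Defs
  imports "HOL-Analysis.Analysis"
begin

(* On real^3^3 the inner product A \<bullet> B is the Frobenius product
   A : B = (\<Sum>i j. A $ i $ j * B $ i $ j); see inner_matrix_3 below. *)

definition sym_matrices :: "(real^3^3) set" where
  "sym_matrices = {A. transpose A = A}"

definition neg_semidef_matrices :: "(real^3^3) set" where
  "neg_semidef_matrices = {A \<in> sym_matrices. \<forall>x. x \<bullet> (A *v x) \<le> 0}"

definition sym_part :: "real^3^3 \<Rightarrow> real^3^3" where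
  "sym_part F = (1/2) *\<^sub>R (F + transpose F)"

(* In the index type 3 the numeral 3 equals 0, so the usual numbering 1, 2, 3 of rows and
   columns is spelled out. *)
definition index_number :: "3 \<Rightarrow> nat" where
  "index_number i = (if i = 1 then 1 else if i = 2 then 2 else 3)"

(* skip_index i is the increasing enumeration (by 1, 2) of the indices {1, 2, 3} - {i}. *)
definition skip_index :: "3 \<Rightarrow> 2 \<Rightarrow> 3" where
  "skip_index i a =
    (if a = 1 then (if i = 1 then 2 else 1)
     else (if i = 3 then 2 else 3))"

definition delete_row_col :: "real^3^3 \<Rightarrow> 3 \<Rightarrow> 3 \<Rightarrow> real^2^2" where
  "delete_row_col F i j = (\<chi> a b. F $ skip_index i a $ skip_index j b)"

definition cof :: "real^3^3 \<Rightarrow> real^3^3" where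
  "cof F = (\<chi> i j. (- 1) ^ (index_number i + index_number j) * det (delete_row_col F i j))"

definition polyconvex :: "(real^3^3 \<Rightarrow> real) \<Rightarrow> bool" where
  "polyconvex h \<longleftrightarrow>
    (\<exists>G :: (real^3^3) \<times> (real^3^3) \<times> real \<Rightarrow> real.
       convex_on UNIV G \<and> (\<forall>F. h F = G (F, cof F, det F)))"

(* A function on symmetric matrices is a total function on real^3^3 of which only the
   values on sym_matrices matter; sym_part F is always symmetric. *)
definition symmetric_polyconvex :: "(real^3^3 \<Rightarrow> real) \<Rightarrow> bool" where
  "symmetric_polyconvex f \<longleftrightarrow> polyconvex (\<lambda>F. f (sym_part F))"

definition partial_subdifferential_2 ::
  "((real^3^3) \<times> (real^3^3) \<Rightarrow> real) \<Rightarrow> real^3^3 \<Rightarrow> real^3^3 \<Rightarrow> (real^3^3) set" where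
  "partial_subdifferential_2 g \<epsilon> \<eta> =
    {B \<in> sym_matrices. \<forall>\<eta>' \<in> sym_matrices. g (\<epsilon>, \<eta>') \<ge> g (\<epsilon>, \<eta>) + B \<bullet> (\<eta>' - \<eta>)}"

lemma inner_matrix_3:
  fixes A B :: "real^3^3"
  shows "A \<bullet> B = (\<Sum>i\<in>UNIV. \<Sum>j\<in>UNIV. A $ i $ j * B $ i $ j)"
  by (simp add: inner_vec_def)

lemma sym_part_in_sym_matrices: "sym_part F \<in> sym_matrices"
  by (simp add: sym_part_def sym_matrices_def transpose_def vec_eq_iff add.commute)

lemma cof_in_sym_matrices:
  assumes "\<epsilon> \<in> sym_matrices"
  shows "cof \<epsilon> \<in> sym_matrices"
proof -
  have sym: "\<epsilon> $ j $ i = \<epsilon> $ i $ j" for i j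
    using arg_cong[of _ _ "\<lambda>A. A $ i $ j"] assms
    by (auto simp: sym_matrices_def transpose_def vec_eq_iff)
  have "cof \<epsilon> $ j $ i = cof \<epsilon> $ i $ j" for i j
    by (simp add: cof_def delete_row_col_def det_2 sym[of "skip_index j _" "skip_index i _"]
        add.commute mult.commute)
  then show ?thesis
    by (simp add: sym_matrices_def transpose_def vec_eq_iff)
qed

lemma mult_transpose_cof: "F ** transpose (cof F) = det F *\<^sub>R mat 1"
proof -
  have "(F ** transpose (cof F)) $ i $ j = (det F *\<^sub>R mat 1) $ i $ j" for i j
    using exhaust_3[of i] exhaust_3[of j]
    by (elim disjE) (simp_all add: cof_def delete_row_col_def index_number_def skip_index_def
        matrix_matrix_mult_def transpose_def mat_def det_2 det_3 sum_3 algebra_simps)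
  then show ?thesis
    by (simp add: vec_eq_iff)
qed

end

theory Submission
  imports Defs
begin

text \<open>
  Everything rests on one identity. Write a matrix as \<open>F = \<epsilon> + W\<close> with \<open>\<epsilon>\<close> its symmetric part and
  \<open>W\<close> skew, and let \<open>w\<close> be the axial vector of \<open>W\<close>. As the cofactor matrix is quadratic in \<open>F\<close>,
  and its mixed part in \<open>\<epsilon>\<close> and \<open>W\<close> is skew, the symmetric part of \<open>cof F\<close> is
  \<open>cof \<epsilon> + w w\<^sup>T\<close> (\<open>sym_part_cof\<close>).

  Let \<open>g\<close> be given. Its partial subgradients are negative semidefinite, and a finite convex function
  has a subgradient everywhere, so \<open>g\<close> does not increase when a positive semidefinite matrix of the
  form \<open>v v\<^sup>T\<close> is added to \<open>\<eta>\<close> (\<open>antimono_if_subdifferential_neg_semidef\<close>). The function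
  \<open>G(F, A, d) = g(sym F, sym A - w w\<^sup>T)\<close> is then convex, because \<open>w \<mapsto> w w\<^sup>T\<close> is convex for the
  Loewner order, with a defect in Jensen's inequality that is again of the form \<open>v v\<^sup>T\<close>. By the
  identity, \<open>G(F, cof F, det F) = g(\<epsilon>, cof \<epsilon>) = f(\<epsilon>)\<close>.

  Conversely, let \<open>f(sym F) = G(F, cof F, det F)\<close> with \<open>G\<close> convex. A subgradient of \<open>G\<close> at
  \<open>(\<epsilon>\<^sub>0, cof \<epsilon>\<^sub>0, det \<epsilon>\<^sub>0)\<close> bounds \<open>f(\<epsilon>)\<close> below by an affine function of
  \<open>(F, cof F, det F)\<close>, for every \<open>F = \<epsilon> + W\<close>. The left side does not see \<open>W\<close>. Averaging over
  \<open>\<plusminus>W\<close> and letting \<open>W\<close> tend to infinity shows that the coefficient \<open>B\<close> of \<open>cof F\<close> has a nonpositive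
  quadratic form and that the coefficient of \<open>det F\<close> vanishes (\<open>cof_minorant_touching\<close>). So
  \<open>f\<close> is the pointwise maximum of functions \<open>c + A : \<epsilon> + B : cof \<epsilon>\<close> with such \<open>B\<close>, and \<open>g\<close> is taken
  as the supremum of the affine functions \<open>c + A : \<epsilon> + B : \<eta>\<close>. It is convex and, as \<open>B\<close> is
  nonpositive, nonincreasing in \<open>\<eta>\<close>, which forces its partial subgradients to be negative semidefinite.
  It remains to see that the supremum is finite. The minorants are controlled on the graph of \<open>cof\<close>,
  hence on its convex hull, and this hull consists of all pairs of symmetric matrices
  because the symmetric matrices are generated additively by cofactors (\<open>cof_generates_sym_matrices\<close>).
\<close>

section \<open>Supporting affine functions of convex functions\<close>

text \<open>
  The strict epigraph, translated so that the base point sits at the origin, omits the origin, and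
  a separating hyperplane cannot be vertical because the function is finite everywhere.
\<close>

lemma convex_on_UNIV_subgradient:
  fixes h :: "'a::euclidean_space \<Rightarrow> real"
  assumes "convex_on UNIV h"
  obtains a where "\<And>y. h y \<ge> h x + a \<bullet> (y - x)"
proof -
  define E where "E = {(u, s). h (x + u) - h x < s}"
  have "convex E"
    unfolding convex_def
  proof (clarsimp simp: E_def)
    fix u s u' s' and p q :: real
    assume s: "h (x + u) - h x < s" "h (x + u') - h x < s'" and pq: "0 \<le> p" "0 \<le> q" "p + q = 1"
    have "x + (p *\<^sub>R u + q *\<^sub>R u') = p *\<^sub>R (x + u) + q *\<^sub>R (x + u')"
      using pq(3) by (simp add: algebra_simps flip: scaleR_add_left)
    then have "h (x + (p *\<^sub>R u + q *\<^sub>R u')) \<le> p * h (x + u) + q * h (x + u')"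
      using assms pq by (simp add: convex_on_def)
    also have "\<dots> = p * (h (x + u) - h x) + q * (h (x + u') - h x) + (p + q) * h x"
      by (simp add: algebra_simps)
    also have "\<dots> < p * s + q * s' + (p + q) * h x"
    proof (cases "p = 0")
      case True
      then show ?thesis using s pq by simp
    next
      case False
      then have "p * (h (x + u) - h x) < p * s" "q * (h (x + u') - h x) \<le> q * s'"
        using s pq by (auto intro: mult_strict_left_mono mult_left_mono)
      then show ?thesis by simp
    qed
    finally show "h (x + (p *\<^sub>R u + q *\<^sub>R u')) - h x < p * s + q * s'"
      using pq by simp
  qed
  moreover have "0 \<notin> E"
    by (simp add: E_def zero_prod_def)
  ultimately obtain z where "z \<noteq> 0" and z: "\<forall>e\<in>E. 0 \<le> z \<bullet> e"
    using separating_hyperplane_set_0 by blast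
  obtain a b where ab: "z = (a, b)" by (cases z)
  have sep: "0 \<le> a \<bullet> u + b * s" if "h (x + u) - h x < s" for u s
    using z that by (force simp: E_def ab)
  have "b \<ge> 0"
    using sep[of 0 1] by simp
  moreover have "b \<noteq> 0"
  proof
    assume "b = 0"
    then have "0 \<le> a \<bullet> (- a)"
      using sep[of "- a" "h (x + - a) - h x + 1"] by simp
    then have "a = 0"
      by (metis inner_gt_zero_iff inner_minus_right neg_0_le_iff_le not_le)
    then show False
      using \<open>b = 0\<close> \<open>z \<noteq> 0\<close> by (simp add: ab zero_prod_def)
  qed
  ultimately have "b > 0" by simp
  have "h y \<ge> h x + (- (1 / b) *\<^sub>R a) \<bullet> (y - x)" for y
  proof (rule field_le_epsilon)
    fix e :: real
    assume "e > 0"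
    then have "0 \<le> a \<bullet> (y - x) + b * (h y - h x + e)"
      by (intro sep) simp
    then have "- (a \<bullet> (y - x)) / b \<le> h y - h x + e"
      using \<open>b > 0\<close> by (simp add: field_simps)
    then show "h x + (- (1 / b) *\<^sub>R a) \<bullet> (y - x) \<le> h y + e"
      by simp
  qed
  then show ?thesis
    using that by blast
qed

section \<open>Symmetric parts, axial vectors and cofactors\<close>

lemma linear_sym_part: "linear sym_part"
  by (rule linearI) (simp_all add: sym_part_def vec_eq_iff transpose_def algebra_simps)

lemma sym_part_of_sym: "A \<in> sym_matrices \<Longrightarrow> sym_part A = A"
  by (simp add: sym_matrices_def sym_part_def flip: scaleR_2)

lemma sym_part_self_adjoint: "sym_part A \<bullet> B = A \<bullet> sym_part B"
  by (simp add: inner_matrix_3 sum_3 sym_part_def transpose_def field_simps)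

lemma subspace_sym_matrices: "subspace sym_matrices"
  by (simp add: subspace_def sym_matrices_def transpose_def vec_eq_iff)

definition outer_square :: "real^'n \<Rightarrow> real^'n^'n" where
  "outer_square v = (\<chi> i j. v $ i * v $ j)"

lemma outer_square_in_sym_matrices: "outer_square v \<in> sym_matrices"
  by (simp add: sym_matrices_def outer_square_def transpose_def vec_eq_iff)

lemma inner_outer_square: "B \<bullet> outer_square v = v \<bullet> (B *v v)"
  for B :: "real^'n^'n"
  by (simp add: inner_vec_def outer_square_def matrix_vector_mult_def sum_distrib_left mult_ac)

lemma outer_square_scaleR: "outer_square (s *\<^sub>R v) = s\<^sup>2 *\<^sub>R outer_square v"
  by (simp add: outer_square_def vec_eq_iff power2_eq_square)

lemma outer_square_convex_combination:
  "outer_square ((1 - t) *\<^sub>R v + t *\<^sub>R w) + outer_square (sqrt (t * (1 - t)) *\<^sub>R (v - w))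
    = (1 - t) *\<^sub>R outer_square v + t *\<^sub>R outer_square w"
  if "0 \<le> t" "t \<le> 1"
proof -
  have "(sqrt (t * (1 - t)))\<^sup>2 = t * (1 - t)"
    using that by simp
  show ?thesis
    unfolding outer_square_scaleR \<open>(sqrt (t * (1 - t)))\<^sup>2 = _\<close>
    by (simp add: outer_square_def vec_eq_iff algebra_simps)
qed

definition axial_vector :: "real^3^3 \<Rightarrow> real^3" where
  "axial_vector F = (1/2) *\<^sub>R
    vector [F $ 3 $ 2 - F $ 2 $ 3, F $ 1 $ 3 - F $ 3 $ 1, F $ 2 $ 1 - F $ 1 $ 2]"

definition cross_matrix :: "real^3 \<Rightarrow> real^3^3" where
  "cross_matrix w =
    vector [vector [0, - w $ 3, w $ 2], vector [w $ 3, 0, - w $ 1], vector [- w $ 2, w $ 1, 0]]"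

lemma linear_axial_vector: "linear axial_vector"
  by (rule linearI) (simp_all add: axial_vector_def vec_eq_iff forall_3 field_simps)

lemma sym_matrices_lower_entries:
  assumes "A \<in> sym_matrices"
  shows "A $ 2 $ 1 = A $ 1 $ 2" "A $ 3 $ 1 = A $ 1 $ 3" "A $ 3 $ 2 = A $ 2 $ 3"
proof -
  have "transpose A $ i $ j = A $ i $ j" for i j
    using assms by (simp add: sym_matrices_def)
  then have "A $ j $ i = A $ i $ j" for i j
    by (simp add: transpose_def)
  then show "A $ 2 $ 1 = A $ 1 $ 2" "A $ 3 $ 1 = A $ 1 $ 3" "A $ 3 $ 2 = A $ 2 $ 3"
    by blast+
qed

lemma sym_part_add_cross: "\<epsilon> \<in> sym_matrices \<Longrightarrow> sym_part (\<epsilon> + cross_matrix w) = \<epsilon>"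
  by (simp add: vec_eq_iff forall_3 sym_part_def transpose_def cross_matrix_def
      sym_matrices_lower_entries)

lemma axial_vector_add_cross: "\<epsilon> \<in> sym_matrices \<Longrightarrow> axial_vector (\<epsilon> + cross_matrix w) = w"
  by (simp add: vec_eq_iff forall_3 axial_vector_def cross_matrix_def sym_matrices_lower_entries)

lemmas cof_entries = cof_def delete_row_col_def index_number_def skip_index_def det_2

lemma cof_transpose: "cof (transpose F) = transpose (cof F)"
  by (simp add: vec_eq_iff forall_3 cof_entries transpose_def)

lemma sym_part_cof:
  "sym_part (cof F) = cof (sym_part F) + outer_square (axial_vector F)"
  by (simp add: vec_eq_iff forall_3 cof_entries transpose_def sym_part_def outer_square_def
      axial_vector_def field_simps)

lemma cof_parallelogram: "cof (X + Y) + cof (X - Y) = 2 *\<^sub>R (cof X + cof Y)"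
  by (simp add: vec_eq_iff forall_3 cof_entries algebra_simps)

lemma cof_scaleR: "cof (r *\<^sub>R X) = r\<^sup>2 *\<^sub>R cof X"
  by (simp add: vec_eq_iff forall_3 cof_entries algebra_simps power2_eq_square)

lemma det_add_cross_matrix:
  assumes "\<epsilon> \<in> sym_matrices"
  shows "det (\<epsilon> + cross_matrix w) = det \<epsilon> + w \<bullet> (\<epsilon> *v w)"
  by (simp add: det_3 cross_matrix_def inner_vec_def matrix_vector_mult_def sum_3
      sym_matrices_lower_entries[OF assms] algebra_simps)

text \<open>
  This is what makes the convex hull of the graph of \<open>cof\<close> exhaust the pairs of symmetric matrices.
  No sign condition restricts sums of cofactors: two diagonal entries \<open>1\<close> and \<open>x\<close> of either sign give
  a cofactor with the single entry \<open>x\<close>, and one off-diagonal pair next to a diagonal entry gives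
  an off-diagonal cofactor of either sign, at the expense of a diagonal entry \<open>-1\<close>.
\<close>

lemma cof_generates_sym_matrices:
  assumes add: "\<And>X Y. X \<in> K \<Longrightarrow> Y \<in> K \<Longrightarrow> X + Y \<in> K"
    and cof: "\<And>X. X \<in> sym_matrices \<Longrightarrow> cof X \<in> K"
    and Z: "Z \<in> sym_matrices"
  shows "Z \<in> K"
proof -
  define M :: "real \<Rightarrow> real \<Rightarrow> real \<Rightarrow> real \<Rightarrow> real \<Rightarrow> real \<Rightarrow> real^3^3" where
    "M a b c p q r = vector [vector [a, p, q], vector [p, b, r], vector [q, r, c]]" for a b c p q r
  have M_sym: "M a b c p q r \<in> sym_matrices" for a b c p q r
    by (simp add: M_def sym_matrices_def transpose_def vec_eq_iff forall_3)
  have M_cof: "cof (M a b c p q r) = M (b * c - r\<^sup>2) (a * c - q\<^sup>2) (a * b - p\<^sup>2)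
      (q * r - p * c) (p * r - q * b) (p * q - a * r)" for a b c p q r
    by (simp add: M_def vec_eq_iff forall_3 cof_entries power2_eq_square)
  have M_add: "M a b c p q r + M a' b' c' p' q' r'
      = M (a + a') (b + b') (c + c') (p + p') (q + q') (r + r')" for a b c p q r a' b' c' p' q' r'
    by (simp add: M_def vec_eq_iff forall_3)
  define a b c p q r where "a = Z $ 1 $ 1" and "b = Z $ 2 $ 2" and "c = Z $ 3 $ 3"
    and "p = Z $ 1 $ 2" and "q = Z $ 1 $ 3" and "r = Z $ 2 $ 3"
  have "Z = M a b c p q r"
    by (simp add: M_def a_def b_def c_def p_def q_def r_def vec_eq_iff forall_3
        sym_matrices_lower_entries[OF Z])
  \<comment> \<open>The shifts by \<open>1\<close> offset the diagonal entries of the last three cofactors.\<close>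
  also have "\<dots> = cof (M 0 1 (a + 1) 0 0 0) + cof (M 1 0 (b + 1) 0 0 0) + cof (M 1 (c + 1) 0 0 0 0)
      + cof (M 0 0 (- p) 1 0 0) + cof (M 0 (- q) 0 0 1 0) + cof (M (- r) 0 0 0 0 1)"
    by (simp add: M_cof M_add)
  also have "\<dots> \<in> K"
    by (intro add cof M_sym)
  finally show ?thesis .
qed

section \<open>From a convex function of strain and cofactor to polyconvexity\<close>

text \<open>
  A subgradient at the larger point \<open>\<eta> + v v\<^sup>T\<close>, tested at \<open>\<eta>\<close>, bounds the increase by
  \<open>v \<bullet> B v \<le> 0\<close>.
\<close>

lemma antimono_if_subdifferential_neg_semidef:
  assumes g: "convex_on (sym_matrices \<times> sym_matrices) g"
    and neg: "\<And>\<zeta>. \<zeta> \<in> sym_matrices \<Longrightarrow>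
      partial_subdifferential_2 g \<epsilon> \<zeta> \<subseteq> neg_semidef_matrices"
    and \<epsilon>: "\<epsilon> \<in> sym_matrices" and \<eta>: "\<eta> \<in> sym_matrices"
  shows "g (\<epsilon>, \<eta> + outer_square v) \<le> g (\<epsilon>, \<eta>)"
proof -
  define \<theta> where "\<theta> = \<eta> + outer_square v"
  have \<theta>: "\<theta> \<in> sym_matrices"
    unfolding \<theta>_def by (intro subspace_add subspace_sym_matrices \<eta> outer_square_in_sym_matrices)
  \<comment> \<open>Composing with the symmetric part extends the section of \<open>g\<close> to all matrices.\<close>
  have "convex_on UNIV (\<lambda>X. g (\<epsilon>, sym_part X))"
  proof (rule convex_onI)
    fix t :: real and X Y
    assume "0 < t" "t < 1"
    then show "g (\<epsilon>, sym_part ((1 - t) *\<^sub>R X + t *\<^sub>R Y))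
        \<le> (1 - t) * g (\<epsilon>, sym_part X) + t * g (\<epsilon>, sym_part Y)"
      using convex_onD[OF g, of t "(\<epsilon>, sym_part X)" "(\<epsilon>, sym_part Y)"] \<epsilon>
      by (simp add: sym_part_in_sym_matrices linear_add[OF linear_sym_part]
          linear_scale[OF linear_sym_part] flip: scaleR_add_left)
  qed simp
  then obtain a where a: "\<And>X. g (\<epsilon>, sym_part X) \<ge> g (\<epsilon>, sym_part \<theta>) + a \<bullet> (X - \<theta>)"
    using convex_on_UNIV_subgradient by blast
  have supp: "g (\<epsilon>, X) \<ge> g (\<epsilon>, \<theta>) + sym_part a \<bullet> (X - \<theta>)" if X: "X \<in> sym_matrices" for X
    using a[of X] X \<theta> subspace_diff[OF subspace_sym_matrices X \<theta>]
    by (simp add: sym_part_self_adjoint sym_part_of_sym)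
  then have "sym_part a \<in> partial_subdifferential_2 g \<epsilon> \<theta>"
    by (simp add: partial_subdifferential_2_def sym_part_in_sym_matrices)
  then have "v \<bullet> (sym_part a *v v) \<le> 0"
    using neg[OF \<theta>] by (auto simp: neg_semidef_matrices_def)
  then show ?thesis
    using supp[OF \<eta>] by (simp add: \<theta>_def inner_outer_square inner_diff_right)
qed

text \<open>
  Subtracting the outer square of the axial vector from the symmetric part of the cofactor argument
  recovers \<open>cof (sym_part F)\<close>. Convexity survives since the subtracted term is convex in \<open>F\<close> for
  the Loewner order and \<open>g\<close> is nonincreasing in its second argument.
\<close>

lemma symmetric_polyconvex_if_convex_antimono:
  assumes g: "convex_on (sym_matrices \<times> sym_matrices) g"
    and anti: "\<And>\<epsilon> \<eta> v. \<epsilon> \<in> sym_matrices \<Longrightarrow> \<eta> \<in> sym_matrices \<Longrightarrow>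
      g (\<epsilon>, \<eta> + outer_square v) \<le> g (\<epsilon>, \<eta>)"
    and f: "\<And>\<epsilon>. \<epsilon> \<in> sym_matrices \<Longrightarrow> f \<epsilon> = g (\<epsilon>, cof \<epsilon>)"
  shows "symmetric_polyconvex f"
proof -
  define N where "N F A = sym_part A - outer_square (axial_vector F)" for F A
  define G where "G = (\<lambda>(F, A, d::real). g (sym_part F, N F A))"
  have N_sym: "N F A \<in> sym_matrices" for F A
    unfolding N_def
    by (intro subspace_diff subspace_sym_matrices sym_part_in_sym_matrices
        outer_square_in_sym_matrices)
  have "convex_on UNIV G"
  proof (rule convex_onI)
    fix t :: real and x y :: "(real^3^3) \<times> (real^3^3) \<times> real"
    assume t: "0 < t" "t < 1"
    obtain F A d F' A' d' where xy: "x = (F, A, d)" "y = (F', A', d')"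
      by (metis prod.exhaust)
    let ?F = "(1 - t) *\<^sub>R F + t *\<^sub>R F'" and ?A = "(1 - t) *\<^sub>R A + t *\<^sub>R A'"
    let ?v = "sqrt (t * (1 - t)) *\<^sub>R (axial_vector F - axial_vector F')"
    \<comment> \<open>The convexity defect of the outer square is itself an outer square.\<close>
    have defect: "outer_square (axial_vector ?F) = (1 - t) *\<^sub>R outer_square (axial_vector F)
        + t *\<^sub>R outer_square (axial_vector F') - outer_square ?v"
      unfolding linear_add[OF linear_axial_vector] linear_scale[OF linear_axial_vector]
      using outer_square_convex_combination[of t "axial_vector F" "axial_vector F'"] t
      by (simp only: eq_diff_eq less_imp_le)
    have N: "N ?F ?A = ((1 - t) *\<^sub>R N F A + t *\<^sub>R N F' A') + outer_square ?v"
      unfolding N_def defect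
      unfolding linear_add[OF linear_sym_part] linear_scale[OF linear_sym_part]
      by (simp add: scaleR_diff_right)
    have "g (sym_part ?F, N ?F ?A) \<le> g (sym_part ?F, (1 - t) *\<^sub>R N F A + t *\<^sub>R N F' A')"
      unfolding N
      by (intro anti sym_part_in_sym_matrices subspace_add subspace_scale subspace_sym_matrices N_sym)
    also have "\<dots> \<le> (1 - t) * g (sym_part F, N F A) + t * g (sym_part F', N F' A')"
      using convex_onD[OF g, of t "(sym_part F, N F A)" "(sym_part F', N F' A')"] t
      by (simp add: N_sym sym_part_in_sym_matrices linear_add[OF linear_sym_part]
          linear_scale[OF linear_sym_part])
    finally show "G ((1 - t) *\<^sub>R x + t *\<^sub>R y) \<le> (1 - t) * G x + t * G y"
      by (simp add: xy G_def)
  qed simp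
  moreover have "f (sym_part F) = G (F, cof F, det F)" for F
    by (simp add: G_def N_def sym_part_cof f sym_part_in_sym_matrices)
  ultimately show ?thesis
    unfolding symmetric_polyconvex_def polyconvex_def by blast
qed

section \<open>Minorants that are affine in strain and cofactor\<close>

text \<open>
  The triple \<open>(A, B, c)\<close> stands for the affine function \<open>c + A : \<epsilon> + B : \<eta>\<close> of a pair of symmetric
  matrices, compared with \<open>f\<close> only on the graph \<open>\<eta> = cof \<epsilon>\<close>.
\<close>

definition cof_minorants :: "(real^3^3 \<Rightarrow> real) \<Rightarrow> ((real^3^3) \<times> (real^3^3) \<times> real) set" where
  "cof_minorants f = {(A, B, c). (\<forall>v. v \<bullet> (B *v v) \<le> 0) \<and>
     (\<forall>\<epsilon>\<in>sym_matrices. c + A \<bullet> \<epsilon> + B \<bullet> cof \<epsilon> \<le> f \<epsilon>)}"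

text \<open>
  The matrices \<open>F\<close> and \<open>F\<^sup>T\<close> have the same symmetric part and determinant. Averaging the subgradient
  inequality over both leaves only symmetric parts, so the axial vector enters quadratically, and its
  quadratic form must be nonpositive for every \<open>\<epsilon>\<close>. Large multiples of the identity of
  both signs then exclude the determinant.
\<close>

lemma cof_minorant_touching:
  assumes f: "symmetric_polyconvex f" and \<epsilon>\<^sub>0: "\<epsilon>\<^sub>0 \<in> sym_matrices"
  obtains A B c where "(A, B, c) \<in> cof_minorants f" "c + A \<bullet> \<epsilon>\<^sub>0 + B \<bullet> cof \<epsilon>\<^sub>0 = f \<epsilon>\<^sub>0"
proof -
  obtain G :: "(real^3^3) \<times> (real^3^3) \<times> real \<Rightarrow> real" where G: "convex_on UNIV G"
    and fG: "\<And>F. f (sym_part F) = G (F, cof F, det F)"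
    using f unfolding symmetric_polyconvex_def polyconvex_def by blast
  obtain a where a: "\<And>y. G y \<ge> G (\<epsilon>\<^sub>0, cof \<epsilon>\<^sub>0, det \<epsilon>\<^sub>0) + a \<bullet> (y - (\<epsilon>\<^sub>0, cof \<epsilon>\<^sub>0, det \<epsilon>\<^sub>0))"
    using convex_on_UNIV_subgradient[OF G] by blast
  obtain A B d where abd: "a = (A, B, d)"
    by (metis prod.exhaust)
  define c where "c = f \<epsilon>\<^sub>0 - A \<bullet> \<epsilon>\<^sub>0 - B \<bullet> cof \<epsilon>\<^sub>0 - d * det \<epsilon>\<^sub>0"
  have G0: "G (\<epsilon>\<^sub>0, cof \<epsilon>\<^sub>0, det \<epsilon>\<^sub>0) = f \<epsilon>\<^sub>0"
    using fG[of \<epsilon>\<^sub>0] \<epsilon>\<^sub>0 by (simp add: sym_part_of_sym)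
  have supp: "c + A \<bullet> F + B \<bullet> cof F + d * det F \<le> f (sym_part F)" for F
    using a[of "(F, cof F, det F)"]
    by (simp add: abd G0 fG c_def inner_diff_right algebra_simps)
  have supp_sym: "c + A \<bullet> sym_part F + B \<bullet> sym_part (cof F) + d * det F \<le> f (sym_part F)" for F
  proof -
    have "sym_part (transpose F) = sym_part F"
      by (simp add: sym_part_def add.commute)
    then have "c + A \<bullet> transpose F + B \<bullet> transpose (cof F) + d * det F \<le> f (sym_part F)"
      using supp[of "transpose F"] by (simp add: cof_transpose)
    moreover have average: "C \<bullet> sym_part X = (C \<bullet> X + C \<bullet> transpose X) / 2" for C X
      by (simp add: sym_part_def inner_add_right)
    ultimately show ?thesis
      unfolding average using supp[of F] by argo
  qed
  have supp_axial: "c + A \<bullet> \<epsilon> + B \<bullet> cof \<epsilon> + d * det \<epsilon> + (w \<bullet> (B *v w) + d * (w \<bullet> (\<epsilon> *v w))) \<le> f \<epsilon>"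
    if "\<epsilon> \<in> sym_matrices" for \<epsilon> w
    using supp_sym[of "\<epsilon> + cross_matrix w"] that
    by (simp add: sym_part_cof sym_part_add_cross axial_vector_add_cross det_add_cross_matrix
        inner_add_right inner_outer_square algebra_simps)
  have quad: "w \<bullet> (B *v w) + d * (w \<bullet> (\<epsilon> *v w)) \<le> 0" if \<epsilon>: "\<epsilon> \<in> sym_matrices" for \<epsilon> w
  proof (rule ccontr)
    define q where "q = w \<bullet> (B *v w) + d * (w \<bullet> (\<epsilon> *v w))"
    define k where "k = f \<epsilon> - (c + A \<bullet> \<epsilon> + B \<bullet> cof \<epsilon> + d * det \<epsilon>)"
    assume "\<not> w \<bullet> (B *v w) + d * (w \<bullet> (\<epsilon> *v w)) \<le> 0"
    then have "q > 0" by (simp add: q_def)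
    have bound: "s\<^sup>2 * q \<le> k" for s :: real
      using supp_axial[OF \<epsilon>, of "s *\<^sub>R w"]
      by (simp add: q_def k_def matrix_vector_mult_scaleR power2_eq_square algebra_simps)
    then have "0 \<le> k"
      using bound[of 0] by simp
    then show False
      using bound[of "sqrt ((k + 1) / q)"] \<open>q > 0\<close> by simp
  qed
  have "d = 0"
  proof (rule ccontr)
    assume "d \<noteq> 0"
    define e :: "real^3" where "e = axis 1 1"
    define t where "t = (1 - e \<bullet> (B *v e)) / d"
    have "t *\<^sub>R mat 1 \<in> sym_matrices"
      by (simp add: sym_matrices_def transpose_def mat_def vec_eq_iff)
    then have "e \<bullet> (B *v e) + d * (e \<bullet> ((t *\<^sub>R mat 1) *v e)) \<le> 0"
      by (rule quad)
    moreover have "e \<bullet> ((t *\<^sub>R mat 1) *v e) = t"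
      by (simp add: e_def inner_axis_axis flip: scaleR_matrix_vector_assoc)
    ultimately show False
      using \<open>d \<noteq> 0\<close> by (simp add: t_def)
  qed
  have "(A, B, c) \<in> cof_minorants f"
    using quad[OF subspace_0[OF subspace_sym_matrices]] supp_axial[of _ 0] \<open>d = 0\<close>
    by (simp add: cof_minorants_def)
  moreover have "c + A \<bullet> \<epsilon>\<^sub>0 + B \<bullet> cof \<epsilon>\<^sub>0 = f \<epsilon>\<^sub>0"
    using \<open>d = 0\<close> by (simp add: c_def)
  ultimately show ?thesis
    using that by blast
qed

text \<open>
  Away from the graph, the value at \<open>(\<epsilon>, cof \<epsilon> + t cof X)\<close> is the average of the values at the graph
  points over \<open>\<epsilon> \<plusminus> \<surd>t X\<close>, so it is bounded by values of \<open>f\<close>. The directions in which such bounds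
  hold for all \<open>t \<ge> 0\<close> are closed under addition, since \<open>cof \<epsilon> + t (X + Y)\<close> is the midpoint of
  \<open>cof \<epsilon> + 2 t X\<close> and \<open>cof \<epsilon> + 2 t Y\<close>, and therefore comprise all symmetric matrices.
\<close>

lemma cof_minorants_bounded:
  assumes \<epsilon>: "\<epsilon> \<in> sym_matrices" and \<eta>: "\<eta> \<in> sym_matrices"
  obtains C where "\<And>A B c. (A, B, c) \<in> cof_minorants f \<Longrightarrow> c + A \<bullet> \<epsilon> + B \<bullet> \<eta> \<le> C"
proof -
  define bounded_at where "bounded_at \<zeta> \<longleftrightarrow>
    (\<exists>C. \<forall>(A, B, c)\<in>cof_minorants f. c + A \<bullet> \<epsilon> + B \<bullet> \<zeta> \<le> C)" for \<zeta>
  define K where "K = {\<zeta>. \<forall>t\<ge>0. bounded_at (cof \<epsilon> + t *\<^sub>R \<zeta>)}"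
  have "\<eta> - cof \<epsilon> \<in> K"
  proof (rule cof_generates_sym_matrices)
    fix X Y
    assume X: "X \<in> K" and Y: "Y \<in> K"
    have "bounded_at (cof \<epsilon> + t *\<^sub>R (X + Y))" if "t \<ge> 0" for t
    proof -
      have "bounded_at (cof \<epsilon> + (2 * t) *\<^sub>R X)" "bounded_at (cof \<epsilon> + (2 * t) *\<^sub>R Y)"
        using X Y that by (auto simp: K_def)
      then obtain C D where C: "\<forall>(A, B, c)\<in>cof_minorants f. c + A \<bullet> \<epsilon> + B \<bullet> (cof \<epsilon> + (2 * t) *\<^sub>R X) \<le> C"
        and D: "\<forall>(A, B, c)\<in>cof_minorants f. c + A \<bullet> \<epsilon> + B \<bullet> (cof \<epsilon> + (2 * t) *\<^sub>R Y) \<le> D"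
        unfolding bounded_at_def by blast
      have "c + A \<bullet> \<epsilon> + B \<bullet> (cof \<epsilon> + t *\<^sub>R (X + Y)) \<le> (C + D) / 2"
        if "(A, B, c) \<in> cof_minorants f" for A B c
        using bspec[OF C that] bspec[OF D that]
        by (simp add: inner_add_right algebra_simps)
      then show ?thesis
        unfolding bounded_at_def by blast
    qed
    then show "X + Y \<in> K"
      by (simp add: K_def)
  next
    fix X
    assume X: "X \<in> sym_matrices"
    have "bounded_at (cof \<epsilon> + t *\<^sub>R cof X)" if "t \<ge> 0" for t
    proof -
      define Y where "Y = sqrt t *\<^sub>R X"
      have Y: "Y \<in> sym_matrices"
        unfolding Y_def by (intro subspace_scale subspace_sym_matrices X)
      have cofY: "cof Y = t *\<^sub>R cof X"
        using that by (simp add: Y_def cof_scaleR)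
      have "c + A \<bullet> \<epsilon> + B \<bullet> (cof \<epsilon> + t *\<^sub>R cof X) \<le> (f (\<epsilon> + Y) + f (\<epsilon> - Y)) / 2"
        if "(A, B, c) \<in> cof_minorants f" for A B c
      proof -
        have "c + A \<bullet> (\<epsilon> + Y) + B \<bullet> cof (\<epsilon> + Y) \<le> f (\<epsilon> + Y)"
          "c + A \<bullet> (\<epsilon> - Y) + B \<bullet> cof (\<epsilon> - Y) \<le> f (\<epsilon> - Y)"
          using that subspace_add[OF subspace_sym_matrices \<epsilon> Y]
            subspace_diff[OF subspace_sym_matrices \<epsilon> Y]
          by (auto simp: cof_minorants_def)
        moreover have "B \<bullet> cof (\<epsilon> + Y) + B \<bullet> cof (\<epsilon> - Y) = 2 * (B \<bullet> (cof \<epsilon> + t *\<^sub>R cof X))"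
          by (simp add: cofY cof_parallelogram flip: inner_add_right)
        ultimately show ?thesis
          by (simp add: inner_add_right inner_diff_right)
      qed
      then show ?thesis
        unfolding bounded_at_def by blast
    qed
    then show "cof X \<in> K"
      by (simp add: K_def)
  next
    show "\<eta> - cof \<epsilon> \<in> sym_matrices"
      by (intro subspace_diff subspace_sym_matrices \<eta> cof_in_sym_matrices \<epsilon>)
  qed
  then have "bounded_at (cof \<epsilon> + 1 *\<^sub>R (\<eta> - cof \<epsilon>))"
    unfolding K_def by (metis (mono_tags, lifting) mem_Collect_eq zero_le_one)
  then have "bounded_at \<eta>"
    by simp
  then show ?thesis
    using that unfolding bounded_at_def by blast
qed

section \<open>The envelope of the minorants\<close>

definition cof_envelope :: "(real^3^3 \<Rightarrow> real) \<Rightarrow> (real^3^3) \<times> (real^3^3) \<Rightarrow> real" where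
  "cof_envelope f = (\<lambda>(\<epsilon>, \<eta>). SUP (A, B, c)\<in>cof_minorants f. c + A \<bullet> \<epsilon> + B \<bullet> \<eta>)"

lemma cof_envelope_upper:
  assumes "\<epsilon> \<in> sym_matrices" "\<eta> \<in> sym_matrices" "(A, B, c) \<in> cof_minorants f"
  shows "c + A \<bullet> \<epsilon> + B \<bullet> \<eta> \<le> cof_envelope f (\<epsilon>, \<eta>)"
proof -
  obtain C where "\<And>A B c. (A, B, c) \<in> cof_minorants f \<Longrightarrow> c + A \<bullet> \<epsilon> + B \<bullet> \<eta> \<le> C"
    using cof_minorants_bounded[OF assms(1,2)] by blast
  then have "bdd_above ((\<lambda>(A, B, c). c + A \<bullet> \<epsilon> + B \<bullet> \<eta>) ` cof_minorants f)"
    by (auto intro!: bdd_aboveI2)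
  from cSUP_upper[OF assms(3) this] show ?thesis
    by (simp add: cof_envelope_def)
qed

lemma cof_envelope_least:
  assumes "cof_minorants f \<noteq> {}"
    and "\<And>A B c. (A, B, c) \<in> cof_minorants f \<Longrightarrow> c + A \<bullet> \<epsilon> + B \<bullet> \<eta> \<le> C"
  shows "cof_envelope f (\<epsilon>, \<eta>) \<le> C"
  unfolding cof_envelope_def using assms by (auto intro!: cSUP_least)

lemma convex_on_cof_envelope:
  assumes "cof_minorants f \<noteq> {}"
  shows "convex_on (sym_matrices \<times> sym_matrices) (cof_envelope f)"
proof (rule convex_onI)
  fix t :: real and x y :: "(real^3^3) \<times> (real^3^3)"
  assume t: "0 < t" "t < 1"
    and mem: "x \<in> sym_matrices \<times> sym_matrices" "y \<in> sym_matrices \<times> sym_matrices"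
  obtain \<epsilon> \<eta> \<epsilon>' \<eta>' where xy: "x = (\<epsilon>, \<eta>)" "y = (\<epsilon>', \<eta>')"
    by (metis prod.exhaust)
  have "cof_envelope f ((1 - t) *\<^sub>R \<epsilon> + t *\<^sub>R \<epsilon>', (1 - t) *\<^sub>R \<eta> + t *\<^sub>R \<eta>')
      \<le> (1 - t) * cof_envelope f x + t * cof_envelope f y"
  proof (rule cof_envelope_least[OF assms])
    fix A B c
    assume "(A, B, c) \<in> cof_minorants f"
    then have "(1 - t) * (c + A \<bullet> \<epsilon> + B \<bullet> \<eta>) + t * (c + A \<bullet> \<epsilon>' + B \<bullet> \<eta>')
        \<le> (1 - t) * cof_envelope f x + t * cof_envelope f y"
      using t mem by (intro add_mono mult_left_mono) (auto simp: xy intro: cof_envelope_upper)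
    then show "c + A \<bullet> ((1 - t) *\<^sub>R \<epsilon> + t *\<^sub>R \<epsilon>') + B \<bullet> ((1 - t) *\<^sub>R \<eta> + t *\<^sub>R \<eta>')
        \<le> (1 - t) * cof_envelope f x + t * cof_envelope f y"
      by (simp add: inner_add_right algebra_simps)
  qed
  then show "cof_envelope f ((1 - t) *\<^sub>R x + t *\<^sub>R y)
      \<le> (1 - t) * cof_envelope f x + t * cof_envelope f y"
    by (simp add: xy)
qed (intro convex_Times subspace_imp_convex subspace_sym_matrices)

lemma cof_envelope_antimono:
  assumes "cof_minorants f \<noteq> {}" "\<epsilon> \<in> sym_matrices" "\<eta> \<in> sym_matrices"
  shows "cof_envelope f (\<epsilon>, \<eta> + outer_square v) \<le> cof_envelope f (\<epsilon>, \<eta>)"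
proof (rule cof_envelope_least[OF assms(1)])
  fix A B c
  assume m: "(A, B, c) \<in> cof_minorants f"
  then have "v \<bullet> (B *v v) \<le> 0"
    by (simp add: cof_minorants_def)
  then show "c + A \<bullet> \<epsilon> + B \<bullet> (\<eta> + outer_square v) \<le> cof_envelope f (\<epsilon>, \<eta>)"
    using cof_envelope_upper[OF assms(2,3) m] by (simp add: inner_add_right inner_outer_square)
qed

lemma cof_envelope_on_graph:
  assumes f: "symmetric_polyconvex f" and \<epsilon>: "\<epsilon> \<in> sym_matrices"
  shows "cof_envelope f (\<epsilon>, cof \<epsilon>) = f \<epsilon>"
proof (rule antisym)
  obtain A B c where m: "(A, B, c) \<in> cof_minorants f" and eq: "c + A \<bullet> \<epsilon> + B \<bullet> cof \<epsilon> = f \<epsilon>"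
    using cof_minorant_touching[OF f \<epsilon>] by blast
  show "f \<epsilon> \<le> cof_envelope f (\<epsilon>, cof \<epsilon>)"
    using cof_envelope_upper[OF \<epsilon> cof_in_sym_matrices[OF \<epsilon>] m] eq by simp
  show "cof_envelope f (\<epsilon>, cof \<epsilon>) \<le> f \<epsilon>"
    using m \<epsilon> by (intro cof_envelope_least) (auto simp: cof_minorants_def)
qed

lemma subdifferential_neg_semidef_if_antimono:
  assumes "\<And>v. g (\<epsilon>, \<eta> + outer_square v) \<le> g (\<epsilon>, \<eta>)" and \<eta>: "\<eta> \<in> sym_matrices"
  shows "partial_subdifferential_2 g \<epsilon> \<eta> \<subseteq> neg_semidef_matrices"
proof
  fix B
  assume "B \<in> partial_subdifferential_2 g \<epsilon> \<eta>"
  then have B: "B \<in> sym_matrices"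
    and sub: "\<And>\<zeta>. \<zeta> \<in> sym_matrices \<Longrightarrow> g (\<epsilon>, \<zeta>) \<ge> g (\<epsilon>, \<eta>) + B \<bullet> (\<zeta> - \<eta>)"
    by (auto simp: partial_subdifferential_2_def)
  have "v \<bullet> (B *v v) \<le> 0" for v
    using sub[of "\<eta> + outer_square v"] assms(1)[of v]
      subspace_add[OF subspace_sym_matrices \<eta> outer_square_in_sym_matrices[of v]]
    by (simp add: inner_outer_square)
  with B show "B \<in> neg_semidef_matrices"
    by (simp add: neg_semidef_matrices_def)
qed

section \<open>The characterization\<close>

theorem theorem5p1:
  fixes f :: "real^3^3 \<Rightarrow> real"
  shows "symmetric_polyconvex f \<longleftrightarrow>
    (\<exists>g :: (real^3^3) \<times> (real^3^3) \<Rightarrow> real.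
       convex_on (sym_matrices \<times> sym_matrices) g \<and>
       (\<forall>\<epsilon> \<in> sym_matrices. \<forall>\<eta> \<in> sym_matrices.
          partial_subdifferential_2 g \<epsilon> \<eta> \<subseteq> neg_semidef_matrices) \<and>
       (\<forall>\<epsilon> \<in> sym_matrices. f \<epsilon> = g (\<epsilon>, cof \<epsilon>)))"
    (is "_ \<longleftrightarrow> (\<exists>g. ?P g)")
proof
  assume f: "symmetric_polyconvex f"
  have "cof_minorants f \<noteq> {}"
    using cof_minorant_touching[OF f subspace_0[OF subspace_sym_matrices]] by blast
  then have "?P (cof_envelope f)"
    using f by (simp add: convex_on_cof_envelope subdifferential_neg_semidef_if_antimono
        cof_envelope_antimono cof_envelope_on_graph)
  then show "\<exists>g. ?P g"
    by (rule exI[where x = "cof_envelope f"])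
next
  assume "\<exists>g. ?P g"
  then obtain g where g: "?P g" ..
  show "symmetric_polyconvex f"
  proof (rule symmetric_polyconvex_if_convex_antimono)
    fix \<epsilon> \<eta> and v :: "real^3"
    assume "\<epsilon> \<in> sym_matrices" "\<eta> \<in> sym_matrices"
    with g show "g (\<epsilon>, \<eta> + outer_square v) \<le> g (\<epsilon>, \<eta>)"
      by (intro antimono_if_subdifferential_neg_semidef) auto
  qed (use g in auto)
qed

end
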